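(* Let $H$ be a real Hilbert space and let $T:H\to H$ be a nonexpansive operator (i.e. $\|Tu-Tv\|\le\|u-v\|$ for all $u,v\in H$) with $Fix(T)=\{x\in H: Tx=x\}\neq\varnothing$. Let $z^{0},z^{-1}\in H$, let $\{e^k\}_{k\ge0}$ be a sequence in $H$, let $\{\alpha_k\}_{k\ge0},\{\lambda_k\}_{k\ge0}$ be real sequences, and define for $k\ge 0$ $$\mu^{k}=z^{k}+\alpha_{k}(z^{k}-z^{k-1}),\qquad z^{k+1}=\mu^{k}+\lambda_{k}(T\mu^{k}+e^{k}-\mu^{k}).$$ Assume: (a) there are constants $\alpha\in[0,1)$ and $\lambda,\lambda'$ with $0<\lambda\le\lambda'<1$ such that $0\le\alpha_k\le\alpha$ and $\lambda\le\lambda_k\le\lambda'$ for all $k$; (b) $\sum_{k=0}^{+\infty}\alpha_k\|z^{k+1}-z^k\|^2<+\infty$ and $\sum_{k=0}^{+\infty}\lambda_k\|e^k\|<+\infty$; (c) the sequence $\{z^k\}$ is bounded. Then: (i) for every $z^*\in Fix(T)$, $\lim_{k\to+\infty}\|z^k-z^*\|$ exists; (ii) $\lim_{k\to+\infty}\|T\mu^k-\mu^k\|=0$; (iii) $\{z^k\}$ converges weakly to a fixed point of $T$. *)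

theory Defs
  imports "HOL-Analysis.Analysis"
begin

definition weakly_converges :: "(nat \<Rightarrow> 'a::real_inner) \<Rightarrow> 'a \<Rightarrow> bool" where
  "weakly_converges x y \<longleftrightarrow> (\<forall>w. ((\<lambda>k. inner (x k) w) \<longlonglongrightarrow> inner y w))"

end

theory Submission
  imports Defs
begin

text \<open>
  Write \<open>d\<^sub>k = z\<^sub>k - z\<^sub>k\<^sub>-\<^sub>1\<close>. The Fejer-type argument for inertial iterations needs
  \<open>\<Sum>\<alpha>\<^sub>k\<parallel>d\<^sub>k\<parallel>\<^sup>2 < \<infinity>\<close>, whereas the hypothesis controls the shifted sum
  \<open>\<Sum>\<alpha>\<^sub>k\<parallel>d\<^sub>k\<^sub>+\<^sub>1\<parallel>\<^sup>2\<close>. The missing bound comes from the residual \<open>q\<^sub>k = z\<^sub>k - T z\<^sub>k\<close>: up to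
  summable terms and a small multiple of \<open>\<alpha>\<^sub>k\<parallel>d\<^sub>k\<parallel>\<^sup>2\<close>, \<open>\<parallel>q\<^sub>k\<parallel>\<^sup>2\<close> is nonincreasing. If
  \<open>\<alpha>\<^sub>k\<^sub>-\<^sub>1\<close> is not small, \<open>\<parallel>d\<^sub>k\<parallel>\<^sup>2\<close> is controlled by the hypothesis. If it is small, then either
  \<open>\<parallel>d\<^sub>k\<^sub>+\<^sub>1\<parallel>\<close> is comparable to \<open>\<parallel>d\<^sub>k\<parallel>\<close>, or the residual drops by an amount comparable to
  \<open>\<parallel>d\<^sub>k\<parallel>\<^sup>2\<close>, because \<open>\<alpha>\<^sub>k\<close> stays away from 1 and \<open>\<lambda>\<^sub>k\<close> from 0 and 1. Hence \<open>\<parallel>q\<^sub>k\<parallel>\<^sup>2\<close> plus a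
  multiple of \<open>\<alpha>\<^sub>k\<parallel>d\<^sub>k\<parallel>\<^sup>2\<close> is a Lyapunov function.

  Weak convergence uses asymptotic centres, minimisers of \<open>u \<mapsto> limsup \<parallel>z\<^sub>k - u\<parallel>\<^sup>2\<close>, in place of
  weak compactness. Those of \<open>z\<close> and of any subsequence are fixed points of \<open>T\<close>; since the
  distances to fixed points converge, they all coincide, and a subsequence with
  \<open>\<langle>z\<^sub>k - p, w\<rangle> \<ge> \<epsilon>\<close> could lower its value at the centre \<open>p\<close> by moving along \<open>w\<close>.
\<close>

section \<open>Real sequences and elementary inequalities\<close>

lemma summable_of_telescoping_descent:
  fixes V S \<sigma> :: "nat \<Rightarrow> real"
  assumes V: "\<And>k. 0 \<le> V k" and S: "\<And>k. 0 \<le> S k" and \<gamma>: "0 < \<gamma>"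
    and \<sigma>: "\<And>k. 0 \<le> \<sigma> k" "summable \<sigma>"
    and step: "\<And>k. V (Suc k) + \<gamma> * S k \<le> V k + \<sigma> k"
  shows "summable S"
proof -
  have "V n + \<gamma> * (\<Sum>k<n. S k) \<le> V 0 + (\<Sum>k<n. \<sigma> k)" for n
  proof (induction n)
    case (Suc n)
    then show ?case using step[of n] by (simp add: algebra_simps)
  qed simp
  moreover have "(\<Sum>k<n. \<sigma> k) \<le> suminf \<sigma>" for n
    using \<sigma> by (intro sum_le_suminf) auto
  ultimately have "\<gamma> * (\<Sum>k<n. S k) \<le> V 0 + suminf \<sigma>" for n
    using V[of n] add_left_mono[of "\<Sum>k<n. \<sigma> k" "suminf \<sigma>" "V 0"]
    by (meson add_increasing order_refl order_trans)
  then have "(\<Sum>k<n. S k) \<le> (V 0 + suminf \<sigma>) / \<gamma>" for n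
    using \<gamma> by (simp add: field_simps)
  then show ?thesis
    using S by (intro bounded_imp_summable[where B = "(V 0 + suminf \<sigma>) / \<gamma>"])
      (auto simp: lessThan_Suc_atMost[symmetric] simp del: sum.lessThan_Suc)
qed

text \<open>The positive parts \<open>t\<close> of the increments of \<phi> contract by the factor
  \<alpha> up to a summable error, hence are summable. Subtracting their partial sums from \<phi>
  leaves a decreasing sequence bounded below.\<close>

lemma inertial_descent_converges:
  fixes \<phi> a \<epsilon> g :: "nat \<Rightarrow> real"
  assumes \<phi>: "\<And>k. 0 \<le> \<phi> k" and g: "\<And>k. 0 \<le> g k"
    and a: "\<And>k. 0 \<le> a k" "\<And>k. a k \<le> \<alpha>" "\<alpha> < 1"
    and \<epsilon>: "\<And>k. 0 \<le> \<epsilon> k" "summable \<epsilon>"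
    and step: "\<And>k. \<phi> (Suc (Suc k)) - \<phi> (Suc k) + g k
                 \<le> a k * (\<phi> (Suc k) - \<phi> k) + \<epsilon> k"
  shows "convergent \<phi>" and "summable g"
proof -
  define t where "t k = max 0 (\<phi> (Suc k) - \<phi> k)" for k
  have t0: "0 \<le> t k" for k by (simp add: t_def)
  have a_t: "a k * (\<phi> (Suc k) - \<phi> k) \<le> \<alpha> * t k" for k
  proof -
    have "a k * (\<phi> (Suc k) - \<phi> k) \<le> a k * t k"
      using a(1) by (intro mult_left_mono) (auto simp: t_def)
    also have "\<dots> \<le> \<alpha> * t k" using a(2) t0 by (intro mult_right_mono)
    finally show ?thesis .
  qed
  have t_Suc: "t (Suc k) \<le> \<alpha> * t k + \<epsilon> k" for k
  proof -
    have "0 \<le> \<alpha> * t k + \<epsilon> k" using a(1)[of k] a(2)[of k] t0[of k] \<epsilon>(1)[of k] by simp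
    then show ?thesis using step[of k] a_t[of k] g[of k] by (simp add: t_def)
  qed
  have t_sum: "summable t"
    by (rule summable_of_telescoping_descent[where V = t and \<sigma> = \<epsilon> and \<gamma> = "1 - \<alpha>"])
      (use t0 \<epsilon> a t_Suc in \<open>auto simp: algebra_simps\<close>)
  define P where "P k = \<phi> k - (\<Sum>j<k. t j)" for k
  have "\<phi> (Suc k) - \<phi> k \<le> t k" for k by (simp add: t_def)
  then have "decseq P" by (intro decseq_SucI) (simp add: P_def algebra_simps)
  moreover have "- suminf t \<le> P k" for k
    using \<phi>[of k] sum_le_suminf[OF t_sum, of "{..<k}"] t0 by (simp add: P_def)
  ultimately have "convergent P" using decseq_convergent[of P "- suminf t"] convergentI by metis
  moreover have "convergent (\<lambda>k. \<Sum>j<k. t j)"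
    using t_sum summable_iff_convergent by blast
  ultimately have "convergent (\<lambda>k. P k + (\<Sum>j<k. t j))" by (rule convergent_add)
  then show "convergent \<phi>" by (simp add: P_def)
  show "summable g"
  proof (rule summable_of_telescoping_descent
      [where V = "\<lambda>k. \<phi> (Suc k)" and \<sigma> = "\<lambda>k. \<alpha> * t k + \<epsilon> k" and \<gamma> = 1])
    show "summable (\<lambda>k. \<alpha> * t k + \<epsilon> k)" using t_sum \<epsilon>(2) by (intro summable_add summable_mult)
    show "0 \<le> \<alpha> * t k + \<epsilon> k" for k
      using a(1)[of k] a(2)[of k] t0[of k] \<epsilon>(1)[of k] by simp
    show "\<phi> (Suc (Suc k)) + 1 * g k \<le> \<phi> (Suc k) + (\<alpha> * t k + \<epsilon> k)" for k
      using step[of k] a_t[of k] by linarith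
  qed (use \<phi> g in auto)
qed

lemma young_weighted:
  fixes a x y \<eta> :: real
  assumes "0 \<le> a" "0 < \<eta>"
  shows "a * x * y \<le> \<eta> * (a * x\<^sup>2) + a * y\<^sup>2 / (4 * \<eta>)"
proof -
  have "0 \<le> a * (2 * \<eta> * x - y)\<^sup>2 / (4 * \<eta>)" using assms by simp
  also have "\<dots> = \<eta> * (a * x\<^sup>2) + a * y\<^sup>2 / (4 * \<eta>) - a * x * y"
    using assms by (simp add: power2_eq_square field_simps)
  finally show ?thesis by simp
qed

lemma sum4_squared_le:
  fixes x y u v :: real
  shows "(x + y + u + v)\<^sup>2 \<le> 4 * (x\<^sup>2 + y\<^sup>2 + u\<^sup>2 + v\<^sup>2)"
proof -
  have "0 \<le> (x - y)\<^sup>2 + (x - u)\<^sup>2 + (x - v)\<^sup>2 + (y - u)\<^sup>2 + (y - v)\<^sup>2 + (u - v)\<^sup>2" by simp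
  also have "\<dots> = 4 * (x\<^sup>2 + y\<^sup>2 + u\<^sup>2 + v\<^sup>2) - (x + y + u + v)\<^sup>2"
    by (simp add: power2_eq_square algebra_simps)
  finally show ?thesis by simp
qed

lemma norm_extrapolation:
  fixes x y :: "'a::real_inner"
  shows "(norm ((1 + c) *\<^sub>R x - c *\<^sub>R y))\<^sup>2
    = (1 + c) * (norm x)\<^sup>2 - c * (norm y)\<^sup>2 + (1 + c) * (c * (norm (x - y))\<^sup>2)"
  unfolding power2_norm_eq_inner
  by (simp add: inner_diff_left inner_diff_right inner_add_left inner_add_right inner_commute
      algebra_simps)

lemma tendsto_zero_of_square:
  fixes f :: "nat \<Rightarrow> real"
  assumes "(\<lambda>k. (f k)\<^sup>2) \<longlonglongrightarrow> 0"
  shows "f \<longlonglongrightarrow> 0"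
  using tendsto_real_sqrt[OF assms] by (simp add: tendsto_rabs_zero_iff)

section \<open>Asymptotic centres and weak convergence\<close>

text \<open>Eventual upper bounds \<open>c\<close> stand in for the limsup, and \<open>m\<close> is
  their infimum over all points. The parallelogram law makes near-minimisers Cauchy, with limit
  \<open>p\<close>. The second property is strong convexity at \<open>p\<close>: it gives uniqueness
  and a quantitative loss at every other point.\<close>

lemma asymptotic_center_exists:
  fixes x :: "nat \<Rightarrow> 'a::{real_inner,complete_space}"
  assumes "bounded (range x)"
  obtains p m where
    "\<And>\<epsilon>. 0 < \<epsilon> \<Longrightarrow> \<forall>\<^sub>F k in sequentially. (norm (x k - p))\<^sup>2 \<le> m + \<epsilon>"
    "\<And>u c. \<forall>\<^sub>F k in sequentially. (norm (x k - u))\<^sup>2 \<le> c \<Longrightarrow> (norm (u - p))\<^sup>2 \<le> 2 * (c - m)"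
proof -
  define R where "R u c \<longleftrightarrow> (\<forall>\<^sub>F k in sequentially. (norm (x k - u))\<^sup>2 \<le> c)" for u c
  have midpoint: "R ((1/2) *\<^sub>R (u + v)) (b/2 + c/2 - (norm (u - v))\<^sup>2 / 4)"
    if "R u b" "R v c" for u v b c
    using that[unfolded R_def] unfolding R_def
  proof eventually_elim
    case (elim k)
    have "(norm (x k - (1/2) *\<^sub>R (u + v)))\<^sup>2
        = (norm (x k - u))\<^sup>2 / 2 + (norm (x k - v))\<^sup>2 / 2 - (norm (u - v))\<^sup>2 / 4"
      unfolding power2_norm_eq_inner
      by (simp add: inner_diff_left inner_diff_right inner_add_left inner_add_right
          inner_commute field_simps)
    then show ?case using elim by linarith
  qed
  have R_nonneg: "0 \<le> c" if "R u c" for u c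
  proof -
    have "\<exists>k. (norm (x k - u))\<^sup>2 \<le> c"
      using that eventually_happens' sequentially_bot unfolding R_def by blast
    then show ?thesis using zero_le_power2 order_trans by blast
  qed
  obtain B where B: "\<And>k. norm (x k) \<le> B" using assms unfolding bounded_iff by auto
  define m where "m = Inf {c. \<exists>u. R u c}"
  have bdd: "bdd_below {c. \<exists>u. R u c}" using R_nonneg by (intro bdd_belowI[of _ 0]) auto
  have "R 0 (B\<^sup>2)" unfolding R_def using B by (auto intro!: always_eventually power_mono)
  then have ne: "{c. \<exists>u. R u c} \<noteq> {}" by blast
  have m_le: "m \<le> c" if "R u c" for u c
    unfolding m_def using that by (intro cInf_lower bdd) auto
  have m0: "0 \<le> m" unfolding m_def using ne R_nonneg by (intro cInf_greatest) auto
  \<comment> \<open>The midpoint cannot beat \<open>m\<close> either, so two nearly optimal points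
    must be close.\<close>
  have dist: "(norm (u - v))\<^sup>2 \<le> 2 * (b - m) + 2 * (c - m)" if "R u b" "R v c" for u v b c
    using m_le[OF midpoint[OF that]] by argo
  have "\<exists>u. R u (m + inverse (Suc n))" for n
  proof -
    have "m < m + inverse (Suc n)" by simp
    then obtain u c where "R u c" "c < m + inverse (Suc n)"
      using cInf_lessD[OF ne, folded m_def] by blast
    then have "R u (m + inverse (Suc n))" unfolding R_def by (auto elim: eventually_mono)
    then show ?thesis ..
  qed
  then obtain u where u: "\<And>n. R (u n) (m + inverse (Suc n))" by metis
  have uu: "(norm (u i - u j))\<^sup>2 \<le> 4 * inverse (Suc N)" if "N \<le> i" "N \<le> j" for i j N
  proof -
    have "inverse (real (Suc i)) \<le> inverse (Suc N)" "inverse (real (Suc j)) \<le> inverse (Suc N)"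
      using that by (auto simp: divide_simps)
    then show ?thesis using dist[OF u[of i] u[of j]] by argo
  qed
  have "Cauchy u"
  proof (rule metric_CauchyI)
    fix e :: real assume "0 < e"
    then obtain N where N: "inverse (real (Suc N)) < e\<^sup>2 / 4"
      using reals_Archimedean[of "e\<^sup>2 / 4"] by auto
    have "dist (u i) (u j) < e" if "N \<le> i" "N \<le> j" for i j
    proof -
      have "(norm (u i - u j))\<^sup>2 < e\<^sup>2" using uu[OF that] N by linarith
      then show ?thesis using \<open>0 < e\<close> by (simp add: dist_norm power_less_imp_less_base)
    qed
    then show "\<exists>M. \<forall>i\<ge>M. \<forall>j\<ge>M. dist (u i) (u j) < e" by blast
  qed
  then obtain p where p: "u \<longlonglongrightarrow> p" using Cauchy_convergent convergent_def by blast
  have Rp: "R p (m + \<epsilon>)" if "0 < \<epsilon>" for \<epsilon>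
  proof -
    \<comment> \<open>The triangle inequality acts on norms while the bounds concern squares, hence
      the square root.\<close>
    have "(\<lambda>n. (sqrt (m + inverse (Suc n)) + norm (u n - p))\<^sup>2) \<longlonglongrightarrow> (sqrt (m + 0) + norm (p - p))\<^sup>2"
      by (intro tendsto_intros p LIMSEQ_inverse_real_of_nat)
    then have "(\<lambda>n. (sqrt (m + inverse (Suc n)) + norm (u n - p))\<^sup>2) \<longlonglongrightarrow> m"
      using m0 by simp
    then have "\<forall>\<^sub>F n in sequentially. (sqrt (m + inverse (Suc n)) + norm (u n - p))\<^sup>2 < m + \<epsilon>"
      by (rule order_tendstoD(2)) (use that in simp)
    then obtain n where n: "(sqrt (m + inverse (Suc n)) + norm (u n - p))\<^sup>2 < m + \<epsilon>"
      using eventually_happens'[OF sequentially_bot] by blast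
    show ?thesis unfolding R_def using u[of n, unfolded R_def]
    proof eventually_elim
      case (elim k)
      have "norm (x k - p) \<le> norm (x k - u n) + norm (u n - p)"
        using norm_triangle_ineq[of "x k - u n" "u n - p"] by simp
      also have "norm (x k - u n) \<le> sqrt (m + inverse (Suc n))"
        using elim by (simp add: real_le_rsqrt)
      finally have "(norm (x k - p))\<^sup>2 \<le> (sqrt (m + inverse (Suc n)) + norm (u n - p))\<^sup>2"
        by (intro power_mono) auto
      then show ?case using n by linarith
    qed
  qed
  show ?thesis
  proof
    show "\<forall>\<^sub>F k in sequentially. (norm (x k - p))\<^sup>2 \<le> m + \<epsilon>" if "0 < \<epsilon>" for \<epsilon>
      using Rp[OF that] by (simp add: R_def)
    show "(norm (v - p))\<^sup>2 \<le> 2 * (c - m)"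
      if "\<forall>\<^sub>F k in sequentially. (norm (x k - v))\<^sup>2 \<le> c" for v c
    proof (rule field_le_epsilon)
      fix e :: real assume "0 < e"
      then show "(norm (v - p))\<^sup>2 \<le> 2 * (c - m) + e"
        using dist[OF that[folded R_def] Rp[of "e/2"]] by simp
    qed
  qed
qed

text \<open>As the residuals vanish, \<open>T p\<close> is asymptotically no farther from the
  sequence than \<open>p\<close>, and \<open>opt\<close> then forces the two to coincide.\<close>

lemma asymptotic_center_fixed:
  fixes x :: "nat \<Rightarrow> 'a::real_inner"
  assumes nonexp: "\<And>u v. norm (T u - T v) \<le> norm (u - v)"
    and res: "(\<lambda>k. norm (T (x k) - x k)) \<longlonglongrightarrow> 0" and bdd: "bounded (range x)"
    and near: "\<And>\<epsilon>. 0 < \<epsilon> \<Longrightarrow> \<forall>\<^sub>F k in sequentially. (norm (x k - p))\<^sup>2 \<le> m + \<epsilon>"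
    and opt: "\<And>u c. \<forall>\<^sub>F k in sequentially. (norm (x k - u))\<^sup>2 \<le> c \<Longrightarrow> (norm (u - p))\<^sup>2 \<le> 2 * (c - m)"
  shows "T p = p"
proof -
  obtain B where B: "\<And>k. norm (x k) \<le> B" using bdd unfolding bounded_iff by auto
  define b where "b = B + norm p"
  have b: "norm (x k - p) \<le> b" for k
    using B[of k] norm_triangle_ineq4[of "x k" p] by (simp add: b_def)
  define r where "r k = norm (T (x k) - x k)" for k
  have "(\<lambda>k. r k * (2 * b + r k)) \<longlonglongrightarrow> 0 * (2 * b + 0)"
    unfolding r_def by (intro tendsto_intros res)
  then have r: "(\<lambda>k. r k * (2 * b + r k)) \<longlonglongrightarrow> 0" by simp
  have "(norm (T p - p))\<^sup>2 \<le> 0 + e" if "0 < e" for e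
  proof -
    have "\<forall>\<^sub>F k in sequentially. r k * (2 * b + r k) < e / 4"
      by (rule order_tendstoD(2)[OF r]) (use that in simp)
    moreover have "\<forall>\<^sub>F k in sequentially. (norm (x k - p))\<^sup>2 \<le> m + e / 4"
      using near that by simp
    ultimately have "\<forall>\<^sub>F k in sequentially. (norm (x k - T p))\<^sup>2 \<le> m + e / 2"
    proof eventually_elim
      case (elim k)
      have "norm (x k - T p) \<le> norm (x k - T (x k)) + norm (T (x k) - T p)"
        using norm_triangle_ineq[of "x k - T (x k)" "T (x k) - T p"] by simp
      also have "\<dots> \<le> r k + norm (x k - p)"
        using nonexp[of "x k" p] by (simp add: r_def norm_minus_commute)
      finally have "(norm (x k - T p))\<^sup>2 \<le> (r k + norm (x k - p))\<^sup>2" by (intro power_mono) auto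
      also have "\<dots> = (norm (x k - p))\<^sup>2 + r k * (2 * norm (x k - p) + r k)"
        by (simp add: power2_eq_square algebra_simps)
      also have "r k * (2 * norm (x k - p) + r k) \<le> r k * (2 * b + r k)"
        using b[of k] by (intro mult_left_mono) (auto simp: r_def)
      finally show ?case using elim by linarith
    qed
    from opt[OF this] show ?thesis by simp
  qed
  then have "(norm (T p - p))\<^sup>2 \<le> 0" by (rule field_le_epsilon)
  then show ?thesis by simp
qed

lemma opial_weak_convergence:
  fixes z :: "nat \<Rightarrow> 'a::{real_inner,complete_space}"
  assumes nonexp: "\<And>u v. norm (T u - T v) \<le> norm (u - v)"
    and res: "(\<lambda>k. norm (T (z k) - z k)) \<longlonglongrightarrow> 0" and bdd: "bounded (range z)"
    and conv: "\<And>p. T p = p \<Longrightarrow> convergent (\<lambda>k. norm (z k - p))"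
  shows "\<exists>p. T p = p \<and> weakly_converges z p"
proof -
  obtain p m where near: "\<And>\<epsilon>. 0 < \<epsilon> \<Longrightarrow> \<forall>\<^sub>F k in sequentially. (norm (z k - p))\<^sup>2 \<le> m + \<epsilon>"
    and opt: "\<And>u c. \<forall>\<^sub>F k in sequentially. (norm (z k - u))\<^sup>2 \<le> c \<Longrightarrow> (norm (u - p))\<^sup>2 \<le> 2 * (c - m)"
    using asymptotic_center_exists[OF bdd] by metis
  have Tp: "T p = p" by (rule asymptotic_center_fixed[OF nonexp res bdd near opt])
  have sq: "\<exists>L. (\<lambda>k. (norm (z k - p))\<^sup>2) \<longlonglongrightarrow> L" if "T p = p" for p
    using conv[OF that] tendsto_power[of "\<lambda>k. norm (z k - p)" _ sequentially 2]
    unfolding convergent_def by metis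
  obtain L where L: "(\<lambda>k. (norm (z k - p))\<^sup>2) \<longlonglongrightarrow> L" using sq[OF Tp] by blast
  have Lm: "L \<le> m"
  proof (rule field_le_epsilon)
    fix e :: real assume "0 < e"
    from tendsto_upperbound[OF L near[OF this]] show "L \<le> m + e" by simp
  qed
  have no_drift: False
    if s: "strict_mono s" and \<epsilon>: "0 < \<epsilon>" and w: "\<And>k. \<epsilon> \<le> inner (z (s k) - p) w"
    for s :: "nat \<Rightarrow> nat" and \<epsilon> w
  proof -
    define y where "y k = z (s k)" for k
    have bdd_y: "bounded (range y)"
      by (rule bounded_subset[OF bdd]) (auto simp: y_def)
    have sub: "(\<lambda>k. f (y k)) \<longlonglongrightarrow> l" if "(\<lambda>k. f (z k)) \<longlonglongrightarrow> l" for f :: "'a \<Rightarrow> real" and l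
      using LIMSEQ_subseq_LIMSEQ[OF that s] by (simp add: o_def y_def)
    have res_y: "(\<lambda>k. norm (T (y k) - y k)) \<longlonglongrightarrow> 0"
      by (rule sub[OF res])
    obtain p' m' where
      near': "\<And>\<epsilon>. 0 < \<epsilon> \<Longrightarrow> \<forall>\<^sub>F k in sequentially. (norm (y k - p'))\<^sup>2 \<le> m' + \<epsilon>"
      and opt': "\<And>u c. \<forall>\<^sub>F k in sequentially. (norm (y k - u))\<^sup>2 \<le> c \<Longrightarrow>
                   (norm (u - p'))\<^sup>2 \<le> 2 * (c - m')"
      using asymptotic_center_exists[OF bdd_y] by metis
    have Tp': "T p' = p'" by (rule asymptotic_center_fixed[OF nonexp res_y bdd_y near' opt'])
    obtain L' where L': "(\<lambda>k. (norm (z k - p'))\<^sup>2) \<longlonglongrightarrow> L'" using sq[OF Tp'] by blast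
    have Lm': "L' \<le> m'"
    proof (rule field_le_epsilon)
      fix e :: real assume "0 < e"
      from tendsto_upperbound[OF sub[OF L'] near'[OF this]] show "L' \<le> m' + e" by simp
    qed
    have 1: "(norm (p - p'))\<^sup>2 \<le> 2 * (L - m')"
    proof (rule field_le_epsilon)
      fix e :: real assume "0 < e"
      then have "\<forall>\<^sub>F k in sequentially. (norm (y k - p))\<^sup>2 < L + e/2"
        by (intro order_tendstoD(2)[OF sub[OF L]]) simp
      then have "\<forall>\<^sub>F k in sequentially. (norm (y k - p))\<^sup>2 \<le> L + e/2"
        by (rule eventually_mono) simp
      from opt'[OF this] show "(norm (p - p'))\<^sup>2 \<le> 2 * (L - m') + e" by simp
    qed
    have 2: "(norm (p' - p))\<^sup>2 \<le> 2 * (L' - m)"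
    proof (rule field_le_epsilon)
      fix e :: real assume "0 < e"
      then have "\<forall>\<^sub>F k in sequentially. (norm (z k - p'))\<^sup>2 < L' + e/2"
        by (intro order_tendstoD(2)[OF L']) simp
      then have "\<forall>\<^sub>F k in sequentially. (norm (z k - p'))\<^sup>2 \<le> L' + e/2"
        by (rule eventually_mono) simp
      from opt[OF this] show "(norm (p' - p))\<^sup>2 \<le> 2 * (L' - m) + e" by simp
    qed
    \<comment> \<open>Adding \<open>1\<close> and \<open>2\<close> pairs \<open>L\<close> with
      \<open>m\<close> and \<open>L'\<close> with \<open>m'\<close>, and both differences are at
      most 0.\<close>
    have "(norm (p - p'))\<^sup>2 \<le> 0"
      using 1 2[unfolded norm_minus_commute[of p']] Lm Lm' by argo
    then have [simp]: "p' = p" by simp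
    define W where "W = (norm w)\<^sup>2"
    have W: "0 \<le> W" by (simp add: W_def)
    \<comment> \<open>The step along \<open>w\<close> is short enough that its quadratic cost
      \<open>t\<^sup>2 * W\<close> stays below \<open>t * \<epsilon>\<close>; the \<open>+ 1\<close>
      makes this strict and the denominator positive.\<close>
    define t where "t = \<epsilon> / (W + 1)"
    have t: "0 < t" "t * W < \<epsilon>"
      using W \<epsilon> by (auto simp: t_def field_simps)
    \<comment> \<open>The slack \<open>t * \<epsilon>\<close> spends half of the gain
      \<open>2 * t * \<epsilon>\<close> that the inner product supplies.\<close>
    have "\<forall>\<^sub>F k in sequentially. (norm (y k - p))\<^sup>2 < L + t * \<epsilon>"
      by (intro order_tendstoD(2)[OF sub[OF L]]) (use t \<epsilon> in simp)
    then have "\<forall>\<^sub>F k in sequentially. (norm (y k - (p + t *\<^sub>R w)))\<^sup>2 \<le> L - t * \<epsilon> + t\<^sup>2 * W"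
    proof eventually_elim
      case (elim k)
      have "(norm (y k - (p + t *\<^sub>R w)))\<^sup>2 =
          (norm (y k - p))\<^sup>2 - 2 * t * inner (y k - p) w + t\<^sup>2 * W"
        unfolding W_def power2_norm_eq_inner
        by (simp add: inner_diff_left inner_diff_right inner_add_left inner_add_right
            inner_commute power2_eq_square algebra_simps)
      moreover have "t * \<epsilon> \<le> t * inner (y k - p) w"
        using w[of k] t by (simp add: y_def)
      ultimately show ?case using elim by simp
    qed
    from opt'[OF this] have "t\<^sup>2 * W \<le> 2 * (L - t * \<epsilon> + t\<^sup>2 * W - m')"
      by (simp add: W_def power_mult_distrib)
    moreover have "L \<le> m'" using Lm' LIMSEQ_unique[OF L] L' by simp
    ultimately have "2 * (t * \<epsilon>) \<le> t * (t * W)" by (simp add: power2_eq_square algebra_simps)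
    then have "2 * \<epsilon> \<le> t * W" using t by (simp add: mult.left_commute)
    then show False using t \<epsilon> by simp
  qed
  have "(\<lambda>k. inner (z k) w) \<longlonglongrightarrow> inner p w" for w
  proof (rule ccontr)
    assume "\<not> ?thesis"
    then obtain \<epsilon> where \<epsilon>: "0 < \<epsilon>"
      and far: "\<exists>\<^sub>F k in sequentially. \<not> dist (inner (z k) w) (inner p w) < \<epsilon>"
      unfolding tendsto_iff not_eventually[symmetric] by blast
    \<comment> \<open>One sign of the deviation occurs infinitely often; replacing \<open>w\<close>
      by \<open>- w\<close> makes it positive.\<close>
    from far have "\<exists>\<^sub>F k in sequentially. \<epsilon> \<le> inner (z k - p) w \<or> \<epsilon> \<le> inner (z k - p) (- w)"
      by (rule frequently_elim1) (auto simp: dist_real_def inner_diff_left)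
    then obtain v where "\<exists>\<^sub>F k in sequentially. \<epsilon> \<le> inner (z k - p) v"
      unfolding frequently_disj_iff by blast
    then have "infinite {k. \<epsilon> \<le> inner (z k - p) v}"
      by (simp add: frequently_cofinite[symmetric] cofinite_eq_sequentially)
    then obtain s :: "nat \<Rightarrow> nat" where "strict_mono s" "\<And>k. s k \<in> {k. \<epsilon> \<le> inner (z k - p) v}"
      using infinite_enumerate by blast
    then show False using no_drift[of s \<epsilon> v] \<epsilon> by simp
  qed
  then show ?thesis using Tp unfolding weakly_converges_def by blast
qed

section \<open>The inertial iteration\<close>

text \<open>The increments \<open>d\<close> are a separate sequence whose value at 0 is left free,
  which absorbs the extra starting point. In this notation \<open>sum_d\<close> visibly pairs
  \<open>a k\<close> with the increment of the next index.\<close>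

locale inertial_km =
  fixes T :: "'a::real_inner \<Rightarrow> 'a" and z d mu e :: "nat \<Rightarrow> 'a"
    and a lam :: "nat \<Rightarrow> real" and \<alpha> l u :: real
  assumes nonexp: "norm (T x - T y) \<le> norm (x - y)"
    and fix_ne: "\<exists>x. T x = x"
    and mu_eq: "mu k = z k + a k *\<^sub>R d k"
    and d_Suc: "d (Suc k) = z (Suc k) - z k"
    and z_Suc: "z (Suc k) = mu k + lam k *\<^sub>R (T (mu k) + e k - mu k)"
    and \<alpha>: "\<alpha> < 1" and l: "0 < l" and u: "u < 1"
    and a: "0 \<le> a k" "a k \<le> \<alpha>"
    and lam: "l \<le> lam k" "lam k \<le> u"
    and sum_d: "summable (\<lambda>k. a k * (norm (d (Suc k)))\<^sup>2)"
    and sum_e: "summable (\<lambda>k. lam k * norm (e k))"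
    and bdd: "bounded (range z)"
begin

definition res_z :: "nat \<Rightarrow> 'a" where "res_z k = z k - T (z k)"
definition res_mu :: "nat \<Rightarrow> 'a" where "res_mu k = mu k - T (mu k)"
definition err :: "nat \<Rightarrow> real" where "err k = lam k * norm (e k)"
text \<open>Change of the residual over the relaxation step from \<open>mu k\<close> to
  \<open>z (Suc k)\<close>; its change over the inertial step from \<open>z k\<close> to
  \<open>mu k\<close> is treated separately.\<close>

definition jump :: "nat \<Rightarrow> 'a" where "jump k = res_z (Suc k) - res_mu k"

section \<open>Parameter bounds and uniform boundedness\<close>

lemma lam_pos: "0 < lam k" using l lam(1)[of k] by linarith
lemma lam_lt_1: "lam k < 1" using u lam(2)[of k] by linarith
lemma l_lt_1: "l < 1" using lam(1)[of 0] lam_lt_1[of 0] by linarith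
lemma a_lt_1: "a k < 1" using a(2)[of k] \<alpha> by linarith
lemma err_nonneg: "0 \<le> err k" using lam_pos[of k] by (simp add: err_def)
lemma summable_err: "summable err" using sum_e by (simp add: err_def[abs_def])

lemma res_fixed_bound:
  assumes "T p = p"
  shows "norm (x - T x) \<le> 2 * norm (x - p)"
proof -
  have "norm (x - T x) \<le> norm (x - p) + norm (T p - T x)"
    using norm_triangle_ineq[of "x - p" "T p - T x"] assms by simp
  then show ?thesis using nonexp[of p x] by (simp add: norm_minus_commute)
qed

lemma uniform_bound:
  obtains M where "1 \<le> M" "\<And>k. norm (d k) \<le> M" "\<And>k. norm (res_z k) \<le> M"
    "\<And>k. norm (res_mu k) \<le> M" "\<And>k. err k \<le> M" "\<And>k. norm (z k) \<le> M"
proof -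
  obtain p where p: "T p = p" using fix_ne by blast
  obtain B where B: "\<And>k. norm (z k) \<le> B" using bdd unfolding bounded_iff by auto
  define D where "D = 2 * B + norm (d 0)"
  have d: "norm (d k) \<le> D" for k
  proof (cases k)
    case 0
    then show ?thesis using order_trans[OF norm_ge_zero B[of 0]] by (simp add: D_def)
  next
    case (Suc j)
    then show ?thesis
      using norm_triangle_ineq4[of "z k" "z j"] B[of k] B[of j] norm_ge_zero[of "d 0"]
      unfolding D_def Suc d_Suc by linarith
  qed
  have mu: "norm (mu k) \<le> B + D" for k
  proof -
    have "norm (mu k) \<le> norm (z k) + a k * norm (d k)"
      using norm_triangle_ineq[of "z k" "a k *\<^sub>R d k"] a(1)[of k] by (simp add: mu_eq)
    moreover have "a k * norm (d k) \<le> 1 * norm (d k)"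
      using a_lt_1[of k] by (intro mult_right_mono) auto
    ultimately show ?thesis using B[of k] d[of k] by simp
  qed
  have q: "norm (res_z k) \<le> 2 * (B + norm p)" for k
    using res_fixed_bound[OF p, of "z k"] norm_triangle_ineq4[of "z k" p] B[of k]
    by (simp add: res_z_def)
  have G: "norm (res_mu k) \<le> 2 * (B + D + norm p)" for k
    using res_fixed_bound[OF p, of "mu k"] norm_triangle_ineq4[of "mu k" p] mu[of k]
    by (simp add: res_mu_def)
  obtain s where s: "\<And>k. err k \<le> s"
    using summable_imp_Bseq[OF summable_err] unfolding Bseq_def by (force simp: abs_le_iff)
  define M where "M = 1 + D + 2 * (B + D + norm p) + \<bar>s\<bar>"
  have nn: "0 \<le> B" "0 \<le> D" using B[of 0] d[of 0] norm_ge_zero order_trans by blast+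
  show ?thesis
  proof
    show "1 \<le> M" using nn by (simp add: M_def)
    fix k
    show "norm (d k) \<le> M" "norm (res_z k) \<le> M" "norm (res_mu k) \<le> M"
      "err k \<le> M" "norm (z k) \<le> M"
      using nn d[of k] q[of k] G[of k] s[of k] B[of k] norm_ge_zero[of p]
      unfolding M_def by argo+
  qed
qed

section \<open>Residuals in terms of increments\<close>

lemma lam_res_mu: "lam k *\<^sub>R res_mu k = a k *\<^sub>R d k - d (Suc k) + lam k *\<^sub>R e k"
  by (simp add: res_mu_def d_Suc z_Suc mu_eq algebra_simps)

lemma norm_res_mu_le: "l * norm (res_mu k) \<le> a k * norm (d k) + norm (d (Suc k)) + err k"
proof -
  have "l * norm (res_mu k) \<le> lam k * norm (res_mu k)"
    using lam(1) by (intro mult_right_mono) auto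
  also have "\<dots> = norm (lam k *\<^sub>R res_mu k)" using lam_pos[of k] by simp
  also have "\<dots> \<le> norm (a k *\<^sub>R d k) + norm (d (Suc k)) + norm (lam k *\<^sub>R e k)"
    unfolding lam_res_mu
    by (meson norm_triangle_ineq norm_triangle_ineq4 add_right_mono order_trans)
  finally show ?thesis using lam_pos[of k] a(1)[of k] by (simp add: err_def)
qed

text \<open>
  The left-hand side is \<open>T (mu k) - T (z k)\<close>. When \<open>d (Suc k)\<close> is negligible,
  \<open>res_mu k\<close> is about \<open>(a k / lam k) *\<^sub>R d k\<close>, so this pins \<open>res_z k\<close> to a ball that misses
  \<open>- d k / lam (k - 1)\<close>, the value it would have if the residual had not dropped.
\<close>
lemma res_z_near: "norm (res_z k - res_mu k + a k *\<^sub>R d k) \<le> a k * norm (d k)"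
proof -
  have "res_z k - res_mu k + a k *\<^sub>R d k = T (mu k) - T (z k)"
    by (simp add: res_z_def res_mu_def mu_eq algebra_simps)
  then show ?thesis using nonexp[of "mu k" "z k"] a(1)[of k] by (simp add: mu_eq)
qed

lemma res_diff: "norm (res_z k - res_mu k) \<le> 2 * a k * norm (d k)"
proof -
  have "norm (res_z k - res_mu k) \<le> norm (res_z k - res_mu k + a k *\<^sub>R d k) + norm (a k *\<^sub>R d k)"
    using norm_triangle_ineq4[of "res_z k - res_mu k + a k *\<^sub>R d k" "a k *\<^sub>R d k"] by simp
  then show ?thesis using res_z_near[of k] a(1)[of k] by simp
qed

section \<open>Residual descent and summability of the inertial terms\<close>

text \<open>Nonexpansiveness between \<open>z (Suc k)\<close> and \<open>mu k\<close> says that the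
  squared jump is at most twice its inner product with the step \<open>w\<close>. As
  \<open>w\<close> is \<open>- lam k *\<^sub>R res_mu k\<close> up to the error, this makes the
  inner product of residual and jump negative enough to leave a gain.\<close>

lemma res_z_descent:
  "(norm (res_z (Suc k)))\<^sup>2 + (1 - u) * (norm (jump k))\<^sup>2
     \<le> (norm (res_mu k))\<^sup>2 + 2 / l * err k * norm (jump k)"
proof -
  define w where "w = z (Suc k) - mu k"
  define \<delta> where "\<delta> = jump k"
  define g where "g = res_mu k"
  define s where "s = lam k *\<^sub>R e k"
  have w: "w = s - lam k *\<^sub>R g"
    by (simp add: w_def g_def s_def z_Suc res_mu_def algebra_simps)
  have "w - \<delta> = T (z (Suc k)) - T (mu k)"
    by (simp add: w_def \<delta>_def jump_def res_z_def res_mu_def)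
  then have "norm (w - \<delta>) \<le> norm w" using nonexp by (simp add: w_def)
  then have "(norm (w - \<delta>))\<^sup>2 \<le> (norm w)\<^sup>2" by (intro power_mono) auto
  then have "(norm \<delta>)\<^sup>2 \<le> 2 * inner w \<delta>"
    unfolding power2_norm_eq_inner
    by (simp add: inner_diff_left inner_diff_right inner_commute)
  also have "\<dots> = 2 * inner s \<delta> - 2 * lam k * inner g \<delta>"
    by (simp add: w inner_diff_left)
  also have "inner s \<delta> \<le> err k * norm \<delta>"
    using norm_cauchy_schwarz[of s \<delta>] lam_pos[of k] by (simp add: s_def err_def)
  finally have "2 * lam k * inner g \<delta> \<le> 2 * (err k * norm \<delta>) - (norm \<delta>)\<^sup>2" by simp
  then have ip: "2 * inner g \<delta> \<le> (2 * (err k * norm \<delta>) - (norm \<delta>)\<^sup>2) / lam k"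
    using lam_pos[of k] by (simp add: field_simps)
  have "2 * (err k * norm \<delta>) / lam k \<le> 2 * (err k * norm \<delta>) / l"
    using lam(1)[of k] l err_nonneg[of k] by (intro divide_left_mono) auto
  \<comment> \<open>The tangent bound \<open>2 - x \<le> 1 / x\<close> suffices: expanding the
    square costs one \<open>(norm \<delta>)\<^sup>2\<close>, and \<open>1 - u\<close>
    remains.\<close>
  moreover have "(2 - u) * (norm \<delta>)\<^sup>2 \<le> (norm \<delta>)\<^sup>2 / lam k"
  proof -
    have "0 \<le> (1 - lam k)\<^sup>2" by simp
    then have "(2 - lam k) * lam k \<le> 1" by (simp add: power2_eq_square algebra_simps)
    then have "2 - lam k \<le> 1 / lam k" using lam_pos[of k] by (simp add: field_simps)
    then have "2 - u \<le> 1 / lam k" using lam(2)[of k] by linarith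
    then show ?thesis using mult_right_mono[of "2 - u" "1 / lam k" "(norm \<delta>)\<^sup>2"] by simp
  qed
  ultimately have "2 * inner g \<delta> \<le> 2 / l * err k * norm \<delta> - (2 - u) * (norm \<delta>)\<^sup>2"
    using ip by (simp add: diff_divide_distrib)
  moreover have "(norm (res_z (Suc k)))\<^sup>2 = (norm g)\<^sup>2 + 2 * inner g \<delta> + (norm \<delta>)\<^sup>2"
  proof -
    have "res_z (Suc k) = g + \<delta>" by (simp add: g_def \<delta>_def jump_def)
    then show ?thesis unfolding power2_norm_eq_inner
      by (simp add: inner_add_left inner_add_right inner_commute)
  qed
  ultimately show ?thesis by (simp add: g_def \<delta>_def algebra_simps)
qed

text \<open>Both residuals at \<open>mu\<close> are solved for the increments and compared through
  \<open>res_z_near\<close>. The increment \<open>d (Suc k)\<close> survives with coefficient at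
  least 1, while the ball of \<open>res_z_near\<close> absorbs at most the fraction \<alpha> of
  it.\<close>

lemma d_Suc_le:
  "(1 - \<alpha>) * l * norm (d (Suc k)) \<le>
     norm (jump k) + a k * norm (d k) + norm (d (Suc (Suc k))) + (err k + err (Suc k))"
proof -
  define i j where "i = 1 / lam k" and "j = 1 / lam (Suc k)"
  define D where "D = d (Suc k)"
  have ij: "1 \<le> i" "i \<le> 1 / l" "1 \<le> j" "j \<le> 1 / l"
    using lam_pos[of k] lam_lt_1[of k] lam_pos[of "Suc k"] lam_lt_1[of "Suc k"] lam(1)[of k]
      lam(1)[of "Suc k"] l by (auto simp: i_def j_def intro!: divide_left_mono)
  have Gk: "res_mu k = i *\<^sub>R (a k *\<^sub>R d k + lam k *\<^sub>R e k) - i *\<^sub>R D"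
    using arg_cong[OF lam_res_mu[of k], of "\<lambda>x. i *\<^sub>R x"] lam_pos[of k]
    by (simp add: i_def D_def algebra_simps)
  have Gk': "res_mu (Suc k) = j *\<^sub>R (a (Suc k) *\<^sub>R D) - j *\<^sub>R (d (Suc (Suc k)) - lam (Suc k) *\<^sub>R e (Suc k))"
    using arg_cong[OF lam_res_mu[of "Suc k"], of "\<lambda>x. j *\<^sub>R x"] lam_pos[of "Suc k"]
    by (simp add: j_def D_def algebra_simps)
  define v where "v = res_z (Suc k) - res_mu (Suc k) + a (Suc k) *\<^sub>R D"
  have v: "norm v \<le> a (Suc k) * norm D" using res_z_near[of "Suc k"] by (simp add: v_def D_def)
  define X where "X = a k *\<^sub>R d k + lam k *\<^sub>R e k"
  define Y where "Y = d (Suc (Suc k)) - lam (Suc k) *\<^sub>R e (Suc k)"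
  have eq: "(i + a (Suc k) * (j - 1)) *\<^sub>R D = jump k + i *\<^sub>R X + j *\<^sub>R Y - v"
    unfolding v_def jump_def X_def Y_def Gk Gk' by (simp add: algebra_simps)
  have X: "norm X \<le> a k * norm (d k) + err k"
    using norm_triangle_ineq[of "a k *\<^sub>R d k" "lam k *\<^sub>R e k"] a(1)[of k] lam_pos[of k]
    by (simp add: X_def err_def)
  have Y: "norm Y \<le> norm (d (Suc (Suc k))) + err (Suc k)"
    using norm_triangle_ineq4[of "d (Suc (Suc k))" "lam (Suc k) *\<^sub>R e (Suc k)"] lam_pos[of "Suc k"]
    by (simp add: Y_def err_def)
  \<comment> \<open>Relaxation below 1 gives \<open>i \<ge> 1\<close> and \<open>j \<ge> 1\<close>,
    so the inertial contribution has the helpful sign.\<close>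
  have "1 * norm D \<le> (i + a (Suc k) * (j - 1)) * norm D"
    using ij a(1)[of "Suc k"] by (intro mult_right_mono) (auto intro: add_increasing2)
  also have "\<dots> = norm ((i + a (Suc k) * (j - 1)) *\<^sub>R D)"
    using ij a(1)[of "Suc k"] by simp
  also have "\<dots> \<le> norm (jump k) + norm (i *\<^sub>R X) + norm (j *\<^sub>R Y) + norm v"
    unfolding eq
    by (meson norm_triangle_ineq norm_triangle_ineq4 add_right_mono order_trans)
  also have "norm (i *\<^sub>R X) \<le> 1 / l * norm X" using ij mult_right_mono[of i "1 / l" "norm X"] by simp
  also have "norm (j *\<^sub>R Y) \<le> 1 / l * norm Y" using ij mult_right_mono[of j "1 / l" "norm Y"] by simp
  also have "norm v \<le> \<alpha> * norm D"
    using v a(2)[of "Suc k"] mult_right_mono[of "a (Suc k)" \<alpha> "norm D"] by simp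
  finally have "(1 - \<alpha>) * norm D \<le> norm (jump k) + 1 / l * norm X + 1 / l * norm Y"
    by (simp add: algebra_simps)
  then have "l * ((1 - \<alpha>) * norm D) \<le> l * (norm (jump k) + 1 / l * norm X + 1 / l * norm Y)"
    using l by (intro mult_left_mono) auto
  also have "\<dots> = l * norm (jump k) + norm X + norm Y" using l by (simp add: algebra_simps)
  also have "l * norm (jump k) \<le> norm (jump k)"
    using l_lt_1 l by (simp add: mult_left_le_one_le)
  finally show ?thesis using X Y by (simp add: D_def mult_ac)
qed

text \<open>This is \<open>d_Suc_le\<close> squared and weighted by \<open>a (Suc k)\<close>. The
  weight is kept on the last increment, where it yields a term of \<open>sum_d\<close>, and
  elsewhere bounded by 1; the bound \<open>M\<close> makes the squared errors linear.\<close>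

lemma S_Suc_le:
  assumes "\<And>k. err k \<le> M"
  shows "((1 - \<alpha>) * l)\<^sup>2 / 4 * (a (Suc k) * (norm (d (Suc k)))\<^sup>2) \<le>
     (norm (jump k))\<^sup>2 + a k * (a k * (norm (d k))\<^sup>2)
     + a (Suc k) * (norm (d (Suc (Suc k))))\<^sup>2 + 2 * M * (err k + err (Suc k))"
proof -
  define s where "s = err k + err (Suc k)"
  have s: "0 \<le> s" "s \<le> 2 * M"
    using assms[of k] assms[of "Suc k"] err_nonneg[of k] err_nonneg[of "Suc k"]
    by (auto simp: s_def)
  have "((1 - \<alpha>) * l * norm (d (Suc k)))\<^sup>2 \<le>
     (norm (jump k) + a k * norm (d k) + norm (d (Suc (Suc k))) + s)\<^sup>2"
    unfolding s_def using d_Suc_le[of k] l \<alpha> by (intro power_mono) auto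
  also have "\<dots> \<le> 4 * ((norm (jump k))\<^sup>2 + (a k * norm (d k))\<^sup>2 + (norm (d (Suc (Suc k))))\<^sup>2 + s\<^sup>2)"
    by (rule sum4_squared_le)
  finally have "((1 - \<alpha>) * l)\<^sup>2 / 4 * (norm (d (Suc k)))\<^sup>2 \<le>
     (norm (jump k))\<^sup>2 + (a k * norm (d k))\<^sup>2 + (norm (d (Suc (Suc k))))\<^sup>2 + s\<^sup>2"
    by (simp add: power_mult_distrib)
  then have "a (Suc k) * (((1 - \<alpha>) * l)\<^sup>2 / 4 * (norm (d (Suc k)))\<^sup>2) \<le>
     a (Suc k) * ((norm (jump k))\<^sup>2 + (a k * norm (d k))\<^sup>2 + (norm (d (Suc (Suc k))))\<^sup>2 + s\<^sup>2)"
    using a(1) by (intro mult_left_mono)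
  then have "((1 - \<alpha>) * l)\<^sup>2 / 4 * (a (Suc k) * (norm (d (Suc k)))\<^sup>2) \<le>
     a (Suc k) * (norm (jump k))\<^sup>2 + a (Suc k) * (a k * norm (d k))\<^sup>2
     + a (Suc k) * (norm (d (Suc (Suc k))))\<^sup>2 + a (Suc k) * s\<^sup>2"
    by (simp only: distrib_left mult.left_commute)
  moreover have "a (Suc k) * (norm (jump k))\<^sup>2 \<le> (norm (jump k))\<^sup>2"
    "a (Suc k) * (a k * norm (d k))\<^sup>2 \<le> (a k * norm (d k))\<^sup>2" "a (Suc k) * s\<^sup>2 \<le> s\<^sup>2"
    using a(1)[of "Suc k"] a_lt_1[of "Suc k"] by (auto intro!: mult_left_le_one_le)
  moreover have "s\<^sup>2 \<le> 2 * M * s" using s by (simp add: power2_eq_square mult_right_mono)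
  moreover have "(a k * norm (d k))\<^sup>2 = a k * (a k * (norm (d k))\<^sup>2)"
    by (simp add: power2_eq_square)
  ultimately show ?thesis unfolding s_def by linarith
qed

lemma summable_inertia: "summable (\<lambda>k. a k * (norm (d k))\<^sup>2)"
proof -
  obtain M where M: "1 \<le> M" "\<And>k. norm (d k) \<le> M" "\<And>k. norm (res_z k) \<le> M"
    "\<And>k. norm (res_mu k) \<le> M" "\<And>k. err k \<le> M"
    using uniform_bound by metis
  define S where "S k = a k * (norm (d k))\<^sup>2" for k
  define S' where "S' k = a k * (norm (d (Suc k)))\<^sup>2" for k
  \<comment> \<open>Here \<open>c\<close> weights the squared jump in \<open>res_z_descent\<close>
    and \<kappa> comes from \<open>S_Suc_le\<close>, so the jump can pay for
    \<open>\<gamma> * S (Suc k)\<close>. \<open>K\<close> covers the coefficients of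
    \<open>\<eta> * S k\<close> in both cases below, and the threshold \<eta> makes the total growth
    only \<open>\<gamma> / 2 * S k\<close>.\<close>
  define c where "c = 1 - u"
  define \<kappa> where "\<kappa> = ((1 - \<alpha>) * l)\<^sup>2 / 4"
  define \<gamma> where "\<gamma> = c * \<kappa>"
  define K where "K = 12 / l"
  define \<eta> where "\<eta> = \<gamma> / (2 * (K + c))"
  have c: "0 < c" "c \<le> 1" using u lam_pos[of 0] lam(2)[of 0] by (auto simp: c_def)
  have K: "0 < K" using l by (simp add: K_def)
  have \<kappa>: "0 < \<kappa>" using \<alpha> l by (simp add: \<kappa>_def)
  have \<gamma>: "0 < \<gamma>" using c \<kappa> by (simp add: \<gamma>_def)
  have \<eta>: "0 < \<eta>" "(K + c) * \<eta> = \<gamma> / 2" using \<gamma> K c by (auto simp: \<eta>_def field_simps)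
  have S0: "0 \<le> S k" "0 \<le> S' k" for k using a(1)[of k] by (auto simp: S_def S'_def)
  \<comment> \<open>\<open>C\<close> and \<open>E\<close> dominate the coefficients of
    \<open>S' k\<close> and of the errors in both cases.\<close>
  define C where "C = 12 / (l * \<eta>) + 4 / \<eta> + \<gamma> / \<eta>"
  define E where "E = 12 * M / l + 2 * M"
  have C0: "0 < C" "0 < E" using l \<eta>(1) \<gamma> M(1) by (auto simp: C_def E_def intro!: add_pos_pos)
  define \<sigma> where "\<sigma> k = C * S' k + c * S' (Suc k) + E * (err k + err (Suc k))" for k
  have \<sigma>0: "0 \<le> \<sigma> k" for k
    using C0 c S0 err_nonneg by (auto simp: \<sigma>_def intro!: add_nonneg_nonneg mult_nonneg_nonneg)
  have S'_sum: "summable S'" unfolding S'_def by (rule sum_d)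
  have "summable (\<lambda>k. S' (Suc k))" "summable (\<lambda>k. err (Suc k))"
    using S'_sum summable_err summable_Suc_iff by blast+
  then have \<sigma>_sum: "summable \<sigma>"
    unfolding \<sigma>_def using S'_sum summable_err by (intro summable_add summable_mult)
  have step: "(norm (res_z (Suc k)))\<^sup>2 + \<gamma> * S (Suc k) \<le> (norm (res_z k))\<^sup>2 + \<gamma> / 2 * S k + \<sigma> k" for k
  proof -
    define q q' g D D' \<delta> s where "q = norm (res_z k)" and "q' = norm (res_z (Suc k))"
      and "g = norm (res_mu k)" and "D = norm (d k)" and "D' = norm (d (Suc k))"
      and "\<delta> = norm (jump k)" and "s = err k"
    have nn: "0 \<le> q" "0 \<le> q'" "0 \<le> g" "0 \<le> D" "0 \<le> D'" "0 \<le> \<delta>" "0 \<le> s"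
      by (auto simp: q_def q'_def g_def D_def D'_def \<delta>_def s_def err_nonneg)
    have ub: "D \<le> M" "D' \<le> M" "\<delta> \<le> 2 * M"
      using M(2)[of k] M(2)[of "Suc k"] norm_triangle_ineq4[of "res_z (Suc k)" "res_mu k"]
        M(3)[of "Suc k"] M(4)[of k]
      by (auto simp: D_def D'_def \<delta>_def jump_def)
    have aD: "a k * D \<le> D" using nn a(1)[of k] a_lt_1[of k] by (intro mult_left_le_one_le) auto
    have Sk: "S k = a k * D\<^sup>2" and S'k: "S' k = a k * D'\<^sup>2" by (auto simp: S_def S'_def D_def D'_def)
    have cross: "a k * D * D' \<le> \<eta> * S k + S' k / (4 * \<eta>)"
      using young_weighted[OF a(1)[of k] \<eta>(1), of D D'] by (simp add: Sk S'k)
    have g_le: "g \<le> (a k * D + D' + s) / l"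
      using norm_res_mu_le[of k] l by (simp add: g_def D_def D'_def s_def field_simps)
    have s_le: "s \<le> err k + err (Suc k)" using err_nonneg by (simp add: s_def)
    show ?thesis
    proof (cases "a k \<le> \<eta>")
      case True \<comment> \<open>the residual can only grow by a small multiple of \<open>S k\<close>, and its drop pays for \<open>S (Suc k)\<close>\<close>
      \<comment> \<open>Squaring \<open>g - 2 * (a k * D) \<le> q\<close> puts \<open>g\<close>, not
        \<open>q\<close>, in the cross term, and \<open>g_le\<close> bounds \<open>g\<close> by
        increments. If the left side is negative, the claim holds by sign alone.\<close>
      have g2: "g\<^sup>2 \<le> q\<^sup>2 + 4 * (a k * D) * g"
      proof -
        have "g \<le> q + 2 * (a k * D)"
          using res_diff[of k] norm_triangle_ineq2[of "res_mu k" "res_z k"]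
          by (simp add: g_def q_def D_def norm_minus_commute)
        then have "g - 2 * (a k * D) \<le> q" by simp
        have "g\<^sup>2 - 4 * (a k * D) * g \<le> q\<^sup>2"
        proof (cases "2 * (a k * D) \<le> g")
          case True
          then have "(g - 2 * (a k * D))\<^sup>2 \<le> q\<^sup>2"
            using \<open>g - 2 * (a k * D) \<le> q\<close> by (intro power_mono) auto
          moreover have "(g - 2 * (a k * D))\<^sup>2 = g\<^sup>2 - 4 * (a k * D) * g + (2 * (a k * D))\<^sup>2"
            by (simp add: power2_eq_square algebra_simps)
          ultimately show ?thesis using zero_le_power2[of "2 * (a k * D)"] by linarith
        next
          case False
          then have "g * g \<le> (2 * (a k * D)) * g" using nn by (intro mult_right_mono) auto
          moreover have "0 \<le> (2 * (a k * D)) * g" using nn a(1) by simp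
          ultimately have "g\<^sup>2 - 4 * (a k * D) * g \<le> 0" unfolding power2_eq_square by linarith
          then show ?thesis using zero_le_power2[of q] by linarith
        qed
        then show ?thesis by simp
      qed
      have "(a k * D) * g \<le> (a k * D) * ((a k * D + D' + s) / l)"
        using g_le nn a(1) by (intro mult_left_mono) auto
      also have "\<dots> = (a k * S k + a k * D * D' + a k * D * s) / l"
        by (simp add: Sk power2_eq_square algebra_simps add_divide_distrib)
      also have "\<dots> \<le> (\<eta> * S k + (\<eta> * S k + S' k / (4 * \<eta>)) + M * s) / l"
      proof (rule divide_right_mono)
        have "a k * S k \<le> \<eta> * S k" using True S0 by (intro mult_right_mono)
        moreover have "a k * D * s \<le> M * s" using aD ub nn by (intro mult_right_mono) auto
        ultimately show "a k * S k + a k * D * D' + a k * D * s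
            \<le> \<eta> * S k + (\<eta> * S k + S' k / (4 * \<eta>)) + M * s"
          using cross by linarith
      qed (use l in simp)
      finally have aDg: "4 * (a k * D) * g \<le> 8 / l * \<eta> * S k + 1 / (l * \<eta>) * S' k + 4 * M / l * s"
        using l \<eta>(1) by (simp add: field_simps)
      have "2 / l * s * \<delta> \<le> 2 / l * s * (2 * M)" using ub nn l by (intro mult_left_mono) auto
      then have q2: "q'\<^sup>2 + c * \<delta>\<^sup>2 \<le> q\<^sup>2 + 8 / l * \<eta> * S k + 1 / (l * \<eta>) * S' k + 8 * M / l * s"
      proof -
        have "q'\<^sup>2 + c * \<delta>\<^sup>2 \<le> g\<^sup>2 + 2 / l * s * \<delta>"
          using res_z_descent[of k] by (simp only: q'_def g_def \<delta>_def c_def s_def)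
        moreover have "2 / l * s * (2 * M) = 4 * M / l * s" "8 * M / l * s = 2 * (4 * M / l * s)"
          by simp_all
        ultimately show ?thesis using \<open>2 / l * s * \<delta> \<le> 2 / l * s * (2 * M)\<close> g2 aDg by linarith
      qed
      have "\<kappa> * S (Suc k) \<le> \<delta>\<^sup>2 + a k * S k + S' (Suc k) + 2 * M * (err k + err (Suc k))"
        using S_Suc_le[OF M(5), of k] by (simp add: \<kappa>_def S_def S'_def \<delta>_def)
      also have "a k * S k \<le> \<eta> * S k" using True S0 by (intro mult_right_mono)
      \<comment> \<open>The factor \<open>c\<close> lets the squared jump cancel against the gain in
        \<open>q2\<close>.\<close>
      finally have "c * (\<kappa> * S (Suc k)) \<le> c * (\<delta>\<^sup>2 + \<eta> * S k + S' (Suc k) + 2 * M * (err k + err (Suc k)))"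
        using c by (intro mult_left_mono) auto
      moreover have "c * (2 * M * (err k + err (Suc k))) \<le> 2 * M * (err k + err (Suc k))"
        using c M(1) err_nonneg by (intro mult_left_le_one_le) auto
      ultimately have S2: "\<gamma> * S (Suc k) \<le> c * \<delta>\<^sup>2 + c * \<eta> * S k + c * S' (Suc k)
          + 2 * M * (err k + err (Suc k))"
        by (simp add: \<gamma>_def algebra_simps)
      have "8 / l * \<eta> * S k \<le> K * \<eta> * S k"
        using l \<eta>(1) S0 by (intro mult_right_mono) (auto simp: K_def divide_right_mono)
      moreover have "K * \<eta> * S k + c * \<eta> * S k = \<gamma> / 2 * S k"
        unfolding \<eta>(2)[symmetric] by (simp add: algebra_simps)
      moreover have "1 / (l * \<eta>) * S' k \<le> C * S' k"
      proof (rule mult_right_mono[OF _ S0(2)])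
        have "1 / (l * \<eta>) \<le> 12 / (l * \<eta>)" using l \<eta>(1) by (intro divide_right_mono) auto
        moreover have "0 \<le> 4 / \<eta> + \<gamma> / \<eta>" using \<eta>(1) \<gamma> by simp
        ultimately show "1 / (l * \<eta>) \<le> C" unfolding C_def by linarith
      qed
      moreover have "8 * M / l * s + 2 * M * (err k + err (Suc k)) \<le> E * (err k + err (Suc k))"
      proof -
        have "8 * M / l * s \<le> 12 * M / l * (err k + err (Suc k))"
          using M(1) l nn s_le by (intro mult_mono divide_right_mono) auto
        then show ?thesis by (simp add: E_def algebra_simps)
      qed
      ultimately show ?thesis
        using q2 S2 unfolding \<sigma>_def q_def[symmetric] q'_def[symmetric] by linarith
    next
      case False \<comment> \<open>\<open>(norm (d (Suc k)))\<^sup>2\<close> is itself of summable size\<close>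
      then have \<eta>a: "\<eta> \<le> a k" by simp
      have D'2: "D'\<^sup>2 \<le> S' k / \<eta>"
        using mult_right_mono[OF \<eta>a, of "D'\<^sup>2"] \<eta>(1) by (simp add: S'k field_simps)
      have "q' \<le> q + 2 * D'"
      proof -
        have "norm (res_z (Suc k) - res_z k) \<le> norm (z (Suc k) - z k) + norm (T (z (Suc k)) - T (z k))"
          unfolding res_z_def by norm
        then have "norm (res_z (Suc k) - res_z k) \<le> 2 * D'"
          using nonexp[of "z (Suc k)" "z k"] by (simp add: D'_def d_Suc)
        then show ?thesis
          using norm_triangle_ineq2[of "res_z (Suc k)" "res_z k"] by (simp add: q_def q'_def)
      qed
      then have "q'\<^sup>2 \<le> (q + 2 * D')\<^sup>2" using nn by (intro power_mono) auto
      then have q2: "q'\<^sup>2 \<le> q\<^sup>2 + 4 * (q * D') + 4 * D'\<^sup>2"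
        by (simp add: power2_eq_square algebra_simps)
      \<comment> \<open>Bounding \<open>q\<close> by increments turns the cross term
        \<open>q * D'\<close> into \<open>a k * D * D'\<close>, which \<open>cross\<close> splits,
        plus summable terms.\<close>
      have "q \<le> g + 2 * (a k * D)"
        using res_diff[of k] norm_triangle_ineq2[of "res_z k" "res_mu k"]
        by (simp add: g_def q_def D_def)
      also have "2 * (a k * D) \<le> 2 * (a k * D) / l"
        using l l_lt_1 nn a(1)[of k] divide_left_mono[of l 1 "2 * (a k * D)"] by simp
      also have "g + 2 * (a k * D) / l \<le> (a k * D + D' + s) / l + 2 * (a k * D) / l"
        using g_le by simp
      also have "\<dots> = (3 * (a k * D) + D' + s) / l"
        unfolding add_divide_distrib[symmetric] by simp
      finally have "q \<le> (3 * (a k * D) + D' + s) / l" by simp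
      then have "q * D' \<le> (3 * (a k * D) + D' + s) / l * D'" using nn by (intro mult_right_mono)
      also have "\<dots> = (3 * (a k * D * D') + D'\<^sup>2 + s * D') / l"
        by (simp add: power2_eq_square algebra_simps add_divide_distrib)
      also have "\<dots> \<le> (3 * (\<eta> * S k + S' k / (4 * \<eta>)) + S' k / \<eta> + s * M) / l"
      proof (rule divide_right_mono)
        show "3 * (a k * D * D') + D'\<^sup>2 + s * D'
            \<le> 3 * (\<eta> * S k + S' k / (4 * \<eta>)) + S' k / \<eta> + s * M"
          by (intro add_mono mult_left_mono cross D'2 ub nn) simp
      qed (use l in simp)
      also have "\<dots> = (K * \<eta> * S k + 7 / (l * \<eta>) * S' k + 4 * M / l * s) / 4"
        using l \<eta>(1) by (simp add: K_def field_simps)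
      finally have "4 * (q * D') \<le> K * \<eta> * S k + 7 / (l * \<eta>) * S' k + 4 * M / l * s"
        by simp
      moreover have "4 * D'\<^sup>2 \<le> 4 / \<eta> * S' k" using D'2 by simp
      moreover have "\<gamma> * S (Suc k) \<le> \<gamma> / \<eta> * S' k"
      proof -
        have "S (Suc k) \<le> D'\<^sup>2"
          unfolding S_def D'_def using a(1) a_lt_1[of "Suc k"] by (intro mult_left_le_one_le) auto
        then have "S (Suc k) \<le> S' k / \<eta>" using D'2 by linarith
        then show ?thesis using \<gamma> mult_left_mono[of "S (Suc k)" "S' k / \<eta>" \<gamma>] by simp
      qed
      moreover have "7 / (l * \<eta>) * S' k + 4 / \<eta> * S' k + \<gamma> / \<eta> * S' k \<le> C * S' k"
      proof -
        have "7 / (l * \<eta>) \<le> 12 / (l * \<eta>)" using l \<eta>(1) by (intro divide_right_mono) auto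
        then have "7 / (l * \<eta>) + 4 / \<eta> + \<gamma> / \<eta> \<le> C" unfolding C_def by linarith
        from mult_right_mono[OF this S0(2)] show ?thesis by (simp add: algebra_simps)
      qed
      moreover have "4 * M / l * s \<le> E * (err k + err (Suc k))"
      proof -
        have "4 * M / l \<le> 12 * M / l" using M(1) l by (intro divide_right_mono) auto
        then have "4 * M / l \<le> E" using M(1) by (simp add: E_def)
        then show ?thesis using nn s_le C0 by (intro mult_mono) auto
      qed
      moreover have "K * \<eta> * S k \<le> \<gamma> / 2 * S k"
        unfolding \<eta>(2)[symmetric] using c \<eta>(1) S0 by (intro mult_right_mono) auto
      moreover have "0 \<le> c * S' (Suc k)" using c S0 by simp
      ultimately show ?thesis
        using q2 unfolding \<sigma>_def q_def[symmetric] q'_def[symmetric] by linarith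
    qed
  qed
  \<comment> \<open>Half of \<open>\<gamma> * S (Suc k)\<close> enters the Lyapunov function; the
    other half is the gain being summed.\<close>
  have "summable (\<lambda>k. S (Suc k))"
    by (rule summable_of_telescoping_descent
          [where V = "\<lambda>k. (norm (res_z k))\<^sup>2 + \<gamma> / 2 * S k" and \<sigma> = \<sigma> and \<gamma> = "\<gamma> / 2"])
      (use \<gamma> S0 \<sigma>0 \<sigma>_sum step in \<open>auto simp: add.commute\<close>)
  then show ?thesis using summable_Suc_iff[of S] by (simp add: S_def[abs_def])
qed

section \<open>Fejer-type estimates and vanishing residuals\<close>

lemma fejer_step:
  assumes p: "T p = p"
  shows "(norm (z (Suc (Suc k)) - p))\<^sup>2 - (norm (z (Suc k) - p))\<^sup>2
       + l * (1 - u) * (norm (res_mu (Suc k)))\<^sup>2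
     \<le> a (Suc k) * ((norm (z (Suc k) - p))\<^sup>2 - (norm (z k - p))\<^sup>2)
       + (2 * (a (Suc k) * (norm (d (Suc k)))\<^sup>2)
          + err (Suc k) * (norm (z (Suc (Suc k)) - p) * 2))"
proof -
  \<comment> \<open>From index 1 on, \<open>d j\<close> is a genuine difference of iterates, so the
    extrapolation identity applies.\<close>
  define j where "j = Suc k"
  define m where "m = mu j - p"
  define t where "t = T (mu j) - p"
  define v where "v = (1 - lam j) *\<^sub>R m + lam j *\<^sub>R t"
  have z': "z (Suc j) - p = v + lam j *\<^sub>R e j"
    by (simp add: v_def m_def t_def z_Suc algebra_simps)
  have "norm t \<le> norm m" using nonexp[of "mu j" p] p by (simp add: t_def m_def)
  then have tm: "(norm t)\<^sup>2 \<le> (norm m)\<^sup>2" by (intro power_mono) auto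
  have "(norm v)\<^sup>2 = (1 - lam j) * (norm m)\<^sup>2 + lam j * (norm t)\<^sup>2 - lam j * (1 - lam j) * (norm (m - t))\<^sup>2"
    unfolding v_def power2_norm_eq_inner
    by (simp add: inner_diff_left inner_diff_right inner_add_left inner_add_right inner_commute
        algebra_simps)
  also have "m - t = res_mu j" by (simp add: m_def t_def res_mu_def)
  also have "lam j * (norm t)\<^sup>2 \<le> lam j * (norm m)\<^sup>2" using tm lam_pos[of j] by simp
  finally have "(norm v)\<^sup>2 \<le> (norm m)\<^sup>2 - lam j * (1 - lam j) * (norm (res_mu j))\<^sup>2"
    by (simp add: algebra_simps)
  moreover have "l * (1 - u) * (norm (res_mu j))\<^sup>2 \<le> lam j * (1 - lam j) * (norm (res_mu j))\<^sup>2"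
    using l u lam[of j] lam_lt_1[of j] by (intro mult_right_mono mult_mono) auto
  \<comment> \<open>Expanding \<open>v\<close> around the new iterate makes the quadratic error term
    favourable, leaving an error linear in \<open>err j\<close>.\<close>
  moreover have "(norm (z (Suc j) - p))\<^sup>2 \<le> (norm v)\<^sup>2 + err j * (norm (z (Suc j) - p) * 2)"
  proof -
    have "(norm (z (Suc j) - p))\<^sup>2 - 2 * inner (z (Suc j) - p) (lam j *\<^sub>R e j) \<le> (norm v)\<^sup>2"
    proof -
      have v: "v = (z (Suc j) - p) - lam j *\<^sub>R e j" by (simp add: z')
      show ?thesis using inner_ge_zero[of "lam j *\<^sub>R e j"] unfolding v power2_norm_eq_inner
        by (simp only: inner_diff_left inner_diff_right) (simp add: inner_commute)
    qed
    moreover have "inner (z (Suc j) - p) (lam j *\<^sub>R e j) \<le> norm (z (Suc j) - p) * err j"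
      using norm_cauchy_schwarz[of "z (Suc j) - p" "lam j *\<^sub>R e j"] lam_pos[of j]
      by (simp add: err_def)
    ultimately show ?thesis by (simp add: algebra_simps)
  qed
  moreover have "(norm m)\<^sup>2 = (1 + a j) * (norm (z j - p))\<^sup>2 - a j * (norm (z k - p))\<^sup>2
      + (1 + a j) * (a j * (norm (d j))\<^sup>2)"
  proof -
    have m: "m = (1 + a j) *\<^sub>R (z j - p) - a j *\<^sub>R (z k - p)"
      and d: "d j = (z j - p) - (z k - p)"
      by (simp_all add: m_def mu_eq j_def d_Suc algebra_simps)
    show ?thesis unfolding m d by (rule norm_extrapolation)
  qed
  moreover have "(1 + a j) * (a j * (norm (d j))\<^sup>2) \<le> 2 * (a j * (norm (d j))\<^sup>2)"
    using a(1)[of j] a_lt_1[of j] by (intro mult_right_mono) auto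
  ultimately show ?thesis unfolding j_def[symmetric] by (simp add: algebra_simps)
qed

lemma fixed_point_distances:
  assumes p: "T p = p"
  shows "convergent (\<lambda>k. norm (z k - p))" and "summable (\<lambda>k. (norm (res_mu k))\<^sup>2)"
proof -
  obtain M where M: "\<And>k. norm (z k) \<le> M" using uniform_bound by metis
  have zp: "norm (z k - p) \<le> M + norm p" for k
    using M[of k] norm_triangle_ineq4[of "z k" p] by simp
  define \<epsilon> where "\<epsilon> k = 2 * (a (Suc k) * (norm (d (Suc k)))\<^sup>2)
          + err (Suc k) * (norm (z (Suc (Suc k)) - p) * 2)" for k
  \<comment> \<open>Boundedness of \<open>z\<close> replaces the varying distance by a constant, so
    summability follows from that of \<open>err\<close>.\<close>
  define \<epsilon>' where "\<epsilon>' k = 2 * (a (Suc k) * (norm (d (Suc k)))\<^sup>2) + err (Suc k) * (2 * (M + norm p))" for k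
  have \<epsilon>\<epsilon>': "\<epsilon> k \<le> \<epsilon>' k" for k
    unfolding \<epsilon>_def \<epsilon>'_def using zp[of "Suc (Suc k)"] err_nonneg
    by (intro add_left_mono mult_left_mono) auto
  have \<epsilon>0: "0 \<le> \<epsilon> k" for k using a(1) err_nonneg by (simp add: \<epsilon>_def)
  have "summable (\<lambda>k. a (Suc k) * (norm (d (Suc k)))\<^sup>2)" "summable (\<lambda>k. err (Suc k))"
    using summable_inertia summable_err
      summable_Suc_iff[of "\<lambda>k. a k * (norm (d k))\<^sup>2"] summable_Suc_iff[of err] by auto
  then have \<epsilon>': "summable \<epsilon>'"
    unfolding \<epsilon>'_def by (intro summable_add summable_mult summable_mult2)
  have \<epsilon>'0: "0 \<le> \<epsilon>' k" for k using \<epsilon>0[of k] \<epsilon>\<epsilon>'[of k] by linarith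
  have g0: "0 \<le> l * (1 - u) * (norm (res_mu (Suc k)))\<^sup>2" for k using l u by simp
  have step: "(norm (z (Suc (Suc k)) - p))\<^sup>2 - (norm (z (Suc k) - p))\<^sup>2
       + l * (1 - u) * (norm (res_mu (Suc k)))\<^sup>2
     \<le> a (Suc k) * ((norm (z (Suc k) - p))\<^sup>2 - (norm (z k - p))\<^sup>2) + \<epsilon>' k" for k
    using fejer_step[OF p, of k] \<epsilon>\<epsilon>'[of k] unfolding \<epsilon>_def by linarith
  note conv = inertial_descent_converges[where \<phi> = "\<lambda>k. (norm (z k - p))\<^sup>2"
      and g = "\<lambda>k. l * (1 - u) * (norm (res_mu (Suc k)))\<^sup>2" and a = "\<lambda>k. a (Suc k)",
      OF zero_le_power2 g0 a(1) a(2) \<alpha> \<epsilon>'0 \<epsilon>' step]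
  obtain L where "(\<lambda>k. (norm (z k - p))\<^sup>2) \<longlonglongrightarrow> L" using conv(1) unfolding convergent_def by blast
  then have "(\<lambda>k. sqrt ((norm (z k - p))\<^sup>2)) \<longlonglongrightarrow> sqrt L" by (rule tendsto_real_sqrt)
  then show "convergent (\<lambda>k. norm (z k - p))" by (auto intro: convergentI)
  have "summable (\<lambda>k. (norm (res_mu (Suc k)))\<^sup>2)"
    using conv(2) l u by (simp add: summable_cmult_iff)
  then show "summable (\<lambda>k. (norm (res_mu k))\<^sup>2)"
    using summable_Suc_iff[of "\<lambda>k. (norm (res_mu k))\<^sup>2"] by simp
qed

lemma res_mu_tendsto: "(\<lambda>k. norm (res_mu k)) \<longlonglongrightarrow> 0"
proof -
  obtain p where "T p = p" using fix_ne by blast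
  from summable_LIMSEQ_zero[OF fixed_point_distances(2)[OF this]] show ?thesis
    by (rule tendsto_zero_of_square)
qed

text \<open>The asymptotic centre argument runs along \<open>z\<close>, so the limit is transferred
  from \<open>mu\<close>; the gap is controlled by \<open>a k * norm (d k)\<close>, whose square is
  at most a term of \<open>summable_inertia\<close>.\<close>

lemma res_z_tendsto: "(\<lambda>k. norm (res_z k)) \<longlonglongrightarrow> 0"
proof -
  have "(\<lambda>k. (a k * norm (d k))\<^sup>2) \<longlonglongrightarrow> 0"
  proof (rule tendsto_sandwich[OF _ _ tendsto_const summable_LIMSEQ_zero[OF summable_inertia]])
    have "(a k * norm (d k))\<^sup>2 \<le> a k * (norm (d k))\<^sup>2" for k
      using a(1)[of k] a_lt_1[of k] mult_left_le_one_le[of "a k * (norm (d k))\<^sup>2" "a k"]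
      by (simp add: power2_eq_square mult_ac)
    then show "\<forall>\<^sub>F k in sequentially. (a k * norm (d k))\<^sup>2 \<le> a k * (norm (d k))\<^sup>2" by simp
  qed simp
  then have "(\<lambda>k. a k * norm (d k)) \<longlonglongrightarrow> 0" by (rule tendsto_zero_of_square)
  then have lim: "(\<lambda>k. norm (res_mu k) + 2 * (a k * norm (d k))) \<longlonglongrightarrow> 0"
    using tendsto_add[OF res_mu_tendsto tendsto_mult_right_zero] by fastforce
  show ?thesis
  proof (rule tendsto_sandwich[OF _ _ tendsto_const lim])
    have "norm (res_z k) \<le> norm (res_mu k) + 2 * (a k * norm (d k))" for k
      using res_diff[of k] norm_triangle_ineq2[of "res_z k" "res_mu k"] by simp
    then show "\<forall>\<^sub>F k in sequentially. norm (res_z k) \<le> norm (res_mu k) + 2 * (a k * norm (d k))"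
      by simp
  qed simp
qed

end

theorem theorem1:
  fixes T :: "'a::{real_inner, complete_space} \<Rightarrow> 'a"
    and z :: "nat \<Rightarrow> 'a" and zm1 :: 'a
    and mu e :: "nat \<Rightarrow> 'a"
    and alpha_seq lam :: "nat \<Rightarrow> real"
    and alph lamb lamu :: real
  assumes nonexp: "\<forall>u v. norm (T u - T v) \<le> norm (u - v)"
    and fix_ne: "\<exists>x. T x = x"
    and mu_def: "\<forall>k. mu k = z k + alpha_seq k *\<^sub>R (z k - (if k = 0 then zm1 else z (k - 1)))"
    and z_step: "\<forall>k. z (Suc k) = mu k + lam k *\<^sub>R (T (mu k) + e k - mu k)"
    and alpha_bnd: "0 \<le> alph" "alph < 1"
    and lam_bnd: "0 < lamb" "lamb \<le> lamu" "lamu < 1"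
    and alpha_seq_bnd: "\<forall>k. 0 \<le> alpha_seq k \<and> alpha_seq k \<le> alph"
    and lam_seq_bnd: "\<forall>k. lamb \<le> lam k \<and> lam k \<le> lamu"
    and sum1: "summable (\<lambda>k. alpha_seq k * (norm (z (Suc k) - z k))\<^sup>2)"
    and sum2: "summable (\<lambda>k. lam k * norm (e k))"
    and bdd: "bounded (range z)"
  shows "(\<forall>p. T p = p \<longrightarrow> convergent (\<lambda>k. norm (z k - p)))
       \<and> ((\<lambda>k. norm (T (mu k) - mu k)) \<longlonglongrightarrow> 0)
       \<and> (\<exists>x. T x = x \<and> weakly_converges z x)"
proof -
  \<comment> \<open>The conditional supplies \<open>d 0\<close> from \<open>zm1\<close>; at
    successors it reduces to consecutive differences.\<close>
  interpret inertial_km T z "\<lambda>k. z k - (if k = 0 then zm1 else z (k - 1))" mu e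
    alpha_seq lam alph lamb lamu
    by unfold_locales (use assms in auto)
  have "(\<lambda>k. norm (T (mu k) - mu k)) \<longlonglongrightarrow> 0"
    using res_mu_tendsto by (simp add: res_mu_def norm_minus_commute)
  moreover have "(\<lambda>k. norm (T (z k) - z k)) \<longlonglongrightarrow> 0"
    using res_z_tendsto by (simp add: res_z_def norm_minus_commute)
  then have "\<exists>x. T x = x \<and> weakly_converges z x"
    using opial_weak_convergence[of T z] nonexp bdd fixed_point_distances(1) by blast
  ultimately show ?thesis using fixed_point_distances(1) by blast
qed

end
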